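(* Let $\mathscr{M}$ be a finitely $1$-generated $\mathbb{N}_0$-graded monoid. Then $\partial\mathscr{M}$ carries naturally a Borel probability measure $\mu_{\mathscr{M}}\colon\mathrm{Bor}(\partial\mathscr{M})\to\mathbb{R}^+\cup\{\infty\}$, namely $$\mu_{\mathscr{M}}(A)=\mu\big((\partial\phi_{\mathscr{M}})^{-1}(A)\big),\qquad A\in\mathrm{Bor}(\partial\mathscr{M}),$$ where $\partial\phi_{\mathscr{M}}\colon\partial\mathscr{F}\to\partial\mathscr{M}$ is the map induced by the canonical homomorphism $\phi_{\mathscr{M}}$ from the free monoid $\mathscr{F}=\mathscr{F}\langle\mathscr{M}_1\rangle$ onto $\mathscr{M}$, and $\mu$ is the canonical probability measure on $\partial\mathscr{F}$.
   Context: Monoids. An $\mathbb{N}_0$-graded monoid is a monoid $\mathscr{M}$ with a monoid homomorphism $|\cdot|\colon\mathscr{M}\to\mathbb{N}_0$; $\mathscr{M}_k=\{x: |x|=k\}$. For a set $Y$, $\mathscr{F}\langle Y\rangle$ is the free monoid on $Y$, graded by word length. $\phi_{\mathscr{M}}\colon\mathscr{F}\langle\mathscr{M}_1\rangle\to\mathscr{M}$ is the homomorphism of graded monoids that is the identity on $\mathscr{M}_1$. $\mathscr{M}$ is finitely $1$-generated if $\phi_{\mathscr{M}}$ is surjective and $\mathscr{M}_1$ is finite. For $x,y\in\mathscr{M}$ put $x\preceq y$ iff $x\mathscr{M}\subseteq y\mathscr{M}$; for $1$-generated monoids this is a partial order. Completion and universal boundary. For a poset $(X,\preceq)$ let $\mathscr{D}(\mathbb{N},X,\preceq)$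 be the set of functions $f\colon\mathbb{N}\to X$ with $f(n)\succeq f(m)$ whenever $n\le m$. For $u,v$ in it put $u\preceq v$ iff for all $n$ there is $k_n$ with $u(k_n)\preceq v(n)$. Write $\min(u)$ for the (unique, if existing) greatest $z\in X$ with $u(n)\succeq z$ for all $n$; $c_z$ is the constant function $z$. Put $u\sim v$ iff ($u\preceq v$ and $v\preceq u$) or ($v\preceq u$ and $v=c_m$ with $m=\min(u)$); let $\approx$ be the equivalence relation generated by $\sim$, $\bar X=\mathscr{D}(\mathbb{N},X,\preceq)/\!\approx$, with $[u]\preceq[v]$ iff $u\preceq v$. $X$ is regarded as a subset of $\bar X$ via $x\mapsto[c_x]$, and $\partial X=\bar X\setminus X$. Cone topology. For $\tau\in X$ let $C_\tau(\bar X)=\{x\in\bar X: x\preceq\tau\}$. The cone topology $\mathcal{T}_c(\bar X)$ on $\bar X$ has as base all sets $\{x\}$ and $C_x(\bar X)$, $x\in X$; $\partial X$ carries the subspace topology, and $\mathrm{Bor}(\partial X)$ is the corresponding Borel $\sigma$-algebra. Measure. If $\mathscr{F}$ is the free monoid on a finite set of cardinality $n$, $\mu\colon\mathrm{Bor}(\partial\mathscr{F})\to\mathbb{R}^+_0$ is the unique probability measure with $\mu(\partial\mathscr{F}\cap C_\tau(\bar{\mathscr{F}}))=n^{-|\tau|}$ for all $\tau\in\mathscr{F}$. The map $\partial\phi_{\mathscr{M}}$ is $[f]\mapsto[\phi_{\mathscr{M}}\circ f]$. *)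

theory Defs
  imports "HOL-Probability.Probability" "HOL-Algebra.Coset"
begin

section \<open>Graded monoids\<close>

locale graded_monoid = monoid M for M (structure) +
  fixes deg :: "'a \<Rightarrow> nat"
  assumes deg_mult: "\<lbrakk>x \<in> carrier M; y \<in> carrier M\<rbrakk> \<Longrightarrow> deg (x \<otimes> y) = deg x + deg y"
    and deg_one: "deg \<one> = 0"

definition degree_part :: "('a, 'b) monoid_scheme \<Rightarrow> ('a \<Rightarrow> nat) \<Rightarrow> nat \<Rightarrow> 'a set"
  where "degree_part M deg k = {x \<in> carrier M. deg x = k}"

definition free_monoid :: "'a set \<Rightarrow> 'a list monoid"
  where "free_monoid Y = \<lparr>carrier = lists Y, mult = (@), one = []\<rparr>"

text \<open>The canonical homomorphism evaluates a word in the elements of degree one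
  to its product.\<close>

definition word_prod :: "('a, 'b) monoid_scheme \<Rightarrow> 'a list \<Rightarrow> 'a"
  where "word_prod M w = foldr (mult M) w (one M)"

locale finitely_1_generated_monoid = graded_monoid M deg for M (structure) and deg +
  assumes one_generated: "word_prod M ` carrier (free_monoid (degree_part M deg 1)) = carrier M"
    and finite_degree_1: "finite (degree_part M deg 1)"

definition monoid_le :: "('a, 'b) monoid_scheme \<Rightarrow> 'a \<Rightarrow> 'a \<Rightarrow> bool"
  where "monoid_le M x y \<longleftrightarrow> x <#\<^bsub>M\<^esub> carrier M \<subseteq> y <#\<^bsub>M\<^esub> carrier M"


section \<open>Completion and universal boundary of a poset\<close>

definition decreasing_seqs :: "'a set \<Rightarrow> ('a \<Rightarrow> 'a \<Rightarrow> bool) \<Rightarrow> (nat \<Rightarrow> 'a) set"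
  where "decreasing_seqs X R = {f. range f \<subseteq> X \<and> (\<forall>n m. n \<le> m \<longrightarrow> R (f m) (f n))}"

definition seq_le :: "('a \<Rightarrow> 'a \<Rightarrow> bool) \<Rightarrow> (nat \<Rightarrow> 'a) \<Rightarrow> (nat \<Rightarrow> 'a) \<Rightarrow> bool"
  where "seq_le R u v \<longleftrightarrow> (\<forall>n. \<exists>k. R (u k) (v n))"

definition is_seq_min :: "'a set \<Rightarrow> ('a \<Rightarrow> 'a \<Rightarrow> bool) \<Rightarrow> (nat \<Rightarrow> 'a) \<Rightarrow> 'a \<Rightarrow> bool"
  where "is_seq_min X R u m \<longleftrightarrow>
    m \<in> X \<and> (\<forall>n. R m (u n)) \<and> (\<forall>z\<in>X. (\<forall>n. R z (u n)) \<longrightarrow> R z m)"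

definition seq_sim ::
    "'a set \<Rightarrow> ('a \<Rightarrow> 'a \<Rightarrow> bool) \<Rightarrow> (nat \<Rightarrow> 'a) \<Rightarrow> (nat \<Rightarrow> 'a) \<Rightarrow> bool"
  where "seq_sim X R u v \<longleftrightarrow>
    u \<in> decreasing_seqs X R \<and> v \<in> decreasing_seqs X R \<and>
    ((seq_le R u v \<and> seq_le R v u) \<or>
     (seq_le R v u \<and> (\<exists>m. is_seq_min X R u m \<and> v = (\<lambda>_. m))))"

definition seq_equiv :: "'a set \<Rightarrow> ('a \<Rightarrow> 'a \<Rightarrow> bool) \<Rightarrow> ((nat \<Rightarrow> 'a) \<times> (nat \<Rightarrow> 'a)) set"
  where "seq_equiv X R = {(u, v). u \<in> decreasing_seqs X R \<and> v \<in> decreasing_seqs X R \<and>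
    equivclp (seq_sim X R) u v}"

definition poset_completion :: "'a set \<Rightarrow> ('a \<Rightarrow> 'a \<Rightarrow> bool) \<Rightarrow> (nat \<Rightarrow> 'a) set set"
  where "poset_completion X R = decreasing_seqs X R // seq_equiv X R"

abbreviation seq_class :: "'a set \<Rightarrow> ('a \<Rightarrow> 'a \<Rightarrow> bool) \<Rightarrow> (nat \<Rightarrow> 'a) \<Rightarrow> (nat \<Rightarrow> 'a) set"
  where "seq_class X R u \<equiv> seq_equiv X R `` {u}"

text \<open>The order on classes is defined through some pair of representatives.  For
  1-generated graded monoids the choice does not matter, see
  \<open>completion_le_class_iff\<close> below.\<close>

definition completion_le ::
    "('a \<Rightarrow> 'a \<Rightarrow> bool) \<Rightarrow> (nat \<Rightarrow> 'a) set \<Rightarrow> (nat \<Rightarrow> 'a) set \<Rightarrow> bool"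
  where "completion_le R A B \<longleftrightarrow> (\<exists>u\<in>A. \<exists>v\<in>B. seq_le R u v)"

definition embed :: "'a set \<Rightarrow> ('a \<Rightarrow> 'a \<Rightarrow> bool) \<Rightarrow> 'a \<Rightarrow> (nat \<Rightarrow> 'a) set"
  where "embed X R x = seq_class X R (\<lambda>_. x)"

definition univ_boundary :: "'a set \<Rightarrow> ('a \<Rightarrow> 'a \<Rightarrow> bool) \<Rightarrow> (nat \<Rightarrow> 'a) set set"
  where "univ_boundary X R = poset_completion X R - embed X R ` X"


text \<open>For 1-generated graded monoids the preorder is antisymmetric, and a decreasing sequence
  of bounded degree is eventually constant.  Hence the second alternative in \<open>seq_sim\<close>
  already implies the first one, and \<open>completion_le\<close> does not depend on
  representatives.\<close>

context finitely_1_generated_monoid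
begin

abbreviation "D \<equiv> decreasing_seqs (carrier M) (monoid_le M)"

lemma monoid_le_iff:
  assumes "x \<in> carrier M" "y \<in> carrier M"
  shows "monoid_le M x y \<longleftrightarrow> (\<exists>z\<in>carrier M. x = y \<otimes> z)"
proof
  assume "monoid_le M x y"
  moreover have "x \<in> x <# carrier M"
    unfolding l_coset_def using assms by (auto intro!: bexI[of _ \<one>])
  ultimately have "x \<in> y <# carrier M" unfolding monoid_le_def by blast
  then show "\<exists>z\<in>carrier M. x = y \<otimes> z" unfolding l_coset_def by auto
next
  assume "\<exists>z\<in>carrier M. x = y \<otimes> z"
  then obtain z where z: "z \<in> carrier M" "x = y \<otimes> z" by blast
  have "x \<otimes> h \<in> y <# carrier M" if "h \<in> carrier M" for h
    unfolding l_coset_def using that z assms(2) by (intro UN_I[of "z \<otimes> h"]) (simp_all add: m_assoc)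
  then show "monoid_le M x y"
    by (auto simp: monoid_le_def l_coset_def[of M x])
qed

lemma monoid_le_refl: "monoid_le M x x"
  by (simp add: monoid_le_def)

lemma monoid_le_trans: "monoid_le M x y \<Longrightarrow> monoid_le M y z \<Longrightarrow> monoid_le M x z"
  by (auto simp: monoid_le_def)

lemma word_prod_degree:
  "set w \<subseteq> degree_part M deg 1 \<Longrightarrow> word_prod M w \<in> carrier M \<and> deg (word_prod M w) = length w"
  by (induction w) (auto simp: word_prod_def degree_part_def deg_one deg_mult)

lemma degree_0: 
  assumes "x \<in> carrier M" "deg x = 0"
  shows "x = \<one>"
proof -
  obtain w where "set w \<subseteq> degree_part M deg 1" "x = word_prod M w"
    using assms(1) one_generated[symmetric] by (auto simp: free_monoid_def)
  with word_prod_degree[of w] assms(2) show ?thesis by (simp add: word_prod_def)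
qed

lemma monoid_le_deg:
  "\<lbrakk>x \<in> carrier M; y \<in> carrier M; monoid_le M x y\<rbrakk> \<Longrightarrow> deg y \<le> deg x"
  by (auto simp: monoid_le_iff deg_mult)

lemma monoid_le_same_deg:
  "\<lbrakk>x \<in> carrier M; y \<in> carrier M; monoid_le M x y; deg x \<le> deg y\<rbrakk> \<Longrightarrow> x = y"
  by (metis monoid_le_iff deg_mult degree_0 r_one add_le_same_cancel1 le_zero_eq)

lemma monoid_le_antisym:
  "\<lbrakk>x \<in> carrier M; y \<in> carrier M; monoid_le M x y; monoid_le M y x\<rbrakk> \<Longrightarrow> x = y"
  using monoid_le_same_deg monoid_le_deg by blast

lemma seq_le_refl: "seq_le (monoid_le M) u u"
  unfolding seq_le_def using monoid_le_refl by blast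

lemma seq_le_trans:
  "seq_le (monoid_le M) u v \<Longrightarrow> seq_le (monoid_le M) v w \<Longrightarrow> seq_le (monoid_le M) u w"
  unfolding seq_le_def using monoid_le_trans by blast

lemma seq_sim_iff:
  "seq_sim (carrier M) (monoid_le M) u v \<longleftrightarrow>
    u \<in> D \<and> v \<in> D \<and> seq_le (monoid_le M) u v \<and> seq_le (monoid_le M) v u"
proof -
  have "seq_le (monoid_le M) u (\<lambda>_. m)"
    if u: "u \<in> D" and m: "is_seq_min (carrier M) (monoid_le M) u m" for m
  proof -
    have uc: "u n \<in> carrier M" for n
      using u by (auto simp: decreasing_seqs_def)
    have mc: "m \<in> carrier M" and mu: "monoid_le M m (u n)" for n
      using m by (auto simp: is_seq_min_def)
    have "finite (range (\<lambda>n. deg (u n)))"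
      using monoid_le_deg[OF mc uc mu] by (auto intro: finite_subset[where B = "{..deg m}"])
    then have "Max (range (\<lambda>n. deg (u n))) \<in> range (\<lambda>n. deg (u n))"
      by (intro Max_in) auto
    then obtain N where "deg (u N) = Max (range (\<lambda>n. deg (u n)))" by auto
    then have N: "deg (u n) \<le> deg (u N)" for n
      using \<open>finite _\<close> by simp
    have "monoid_le M (u N) (u n)" for n
    proof (cases "n \<le> N")
      case True
      then show ?thesis using u by (auto simp: decreasing_seqs_def)
    next
      case False
      then have "monoid_le M (u n) (u N)" using u by (auto simp: decreasing_seqs_def)
      then have "u n = u N" using monoid_le_same_deg[OF uc uc] N by blast
      then show ?thesis by (simp add: monoid_le_refl)
    qed
    then have "monoid_le M (u N) m" using m uc by (auto simp: is_seq_min_def)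
    then show ?thesis unfolding seq_le_def by blast
  qed
  then show ?thesis unfolding seq_sim_def by blast
qed

lemma seq_equiv_iff:
  "(u, v) \<in> seq_equiv (carrier M) (monoid_le M) \<longleftrightarrow>
    u \<in> D \<and> v \<in> D \<and> seq_le (monoid_le M) u v \<and> seq_le (monoid_le M) v u"
proof -
  have "seq_le (monoid_le M) u v \<and> seq_le (monoid_le M) v u"
    if "equivclp (seq_sim (carrier M) (monoid_le M)) u v"
    using that
  proof (induction rule: equivclp_induct)
    case base
    show ?case by (simp add: seq_le_refl)
  next
    case (step y z)
    then show ?case using seq_le_trans by (auto simp: seq_sim_iff)
  qed
  moreover have "equivclp (seq_sim (carrier M) (monoid_le M)) u v"
    if "seq_sim (carrier M) (monoid_le M) u v"
    using that unfolding equivclp_def by (blast intro: symclpI1)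
  ultimately show ?thesis
    unfolding seq_equiv_def mem_Collect_eq case_prod_conv using seq_sim_iff[of u v] by blast
qed

lemma completion_le_class_iff:
  assumes "u \<in> D" "v \<in> D"
  shows "completion_le (monoid_le M) (seq_class (carrier M) (monoid_le M) u)
      (seq_class (carrier M) (monoid_le M) v) \<longleftrightarrow> seq_le (monoid_le M) u v"
proof -
  have "u \<in> seq_class (carrier M) (monoid_le M) u" "v \<in> seq_class (carrier M) (monoid_le M) v"
    using assms seq_le_refl by (simp_all add: seq_equiv_iff)
  then show ?thesis
    using seq_le_trans unfolding completion_le_def
    by (metis Image_singleton_iff seq_equiv_iff)
qed

end

section \<open>Cone topology and Borel sets\<close>

definition completion_cone ::
    "'a set \<Rightarrow> ('a \<Rightarrow> 'a \<Rightarrow> bool) \<Rightarrow> 'a \<Rightarrow> (nat \<Rightarrow> 'a) set set"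
  where "completion_cone X R t =
    {A \<in> poset_completion X R. completion_le R A (embed X R t)}"

definition cone_base :: "'a set \<Rightarrow> ('a \<Rightarrow> 'a \<Rightarrow> bool) \<Rightarrow> (nat \<Rightarrow> 'a) set set set"
  where "cone_base X R = (\<lambda>x. {embed X R x}) ` X \<union> completion_cone X R ` X"

definition cone_topology :: "'a set \<Rightarrow> ('a \<Rightarrow> 'a \<Rightarrow> bool) \<Rightarrow> (nat \<Rightarrow> 'a) set topology"
  where "cone_topology X R = topology_generated_by (cone_base X R)"

text \<open>For 1-generated graded monoids \<open>cone_base\<close> is indeed a base of the topology
  it generates.\<close>

lemma (in finitely_1_generated_monoid) openin_cone_topology_iff:
  "openin (cone_topology (carrier M) (monoid_le M)) =
    arbitrary union_of (\<lambda>U. U \<in> cone_base (carrier M) (monoid_le M))"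
proof -
  let ?B = "\<lambda>U. U \<in> cone_base (carrier M) (monoid_le M)"
  let ?cone = "completion_cone (carrier M) (monoid_le M)"
  have const: "(\<lambda>_. x) \<in> D" if "x \<in> carrier M" for x
    using that by (auto simp: decreasing_seqs_def monoid_le_refl)
  have local_base: "\<exists>W. ?B W \<and> A \<in> W \<and> W \<subseteq> ?cone x \<inter> ?cone y"
    if x: "x \<in> carrier M" and y: "y \<in> carrier M" and A: "A \<in> ?cone x \<inter> ?cone y" for A x y
  proof -
    obtain u where u: "u \<in> D" "A = seq_class (carrier M) (monoid_le M) u"
      using A by (auto simp: completion_cone_def poset_completion_def elim: quotientE)
    then obtain i j where ij: "monoid_le M (u i) x" "monoid_le M (u j) y"
      using A x y const
      by (auto simp: completion_cone_def embed_def completion_le_class_iff seq_le_def)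
    define t where "t = u (max i j)"
    have t: "t \<in> carrier M" using u by (auto simp: t_def decreasing_seqs_def)
    have "monoid_le M t (u i)" "monoid_le M t (u j)"
      using u by (auto simp: t_def decreasing_seqs_def)
    then have tx: "monoid_le M t x" and ty: "monoid_le M t y"
      using ij monoid_le_trans by blast+
    have "?cone t \<subseteq> ?cone x \<inter> ?cone y"
    proof
      fix B assume B: "B \<in> ?cone t"
      then obtain v where v: "v \<in> D" "B = seq_class (carrier M) (monoid_le M) v"
        by (auto simp: completion_cone_def poset_completion_def elim: quotientE)
      with B t const obtain k where "monoid_le M (v k) t"
        by (auto simp: completion_cone_def embed_def completion_le_class_iff seq_le_def)
      then have "monoid_le M (v k) x" "monoid_le M (v k) y"
        using tx ty monoid_le_trans by blast+
      with B v x y const show "B \<in> ?cone x \<inter> ?cone y"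
        by (auto simp: completion_cone_def embed_def completion_le_class_iff seq_le_def)
    qed
    moreover have "A \<in> ?cone t"
      using A u t const monoid_le_refl
      by (auto simp: completion_cone_def embed_def completion_le_class_iff seq_le_def t_def)
    ultimately show ?thesis using t by (auto simp: cone_base_def)
  qed
  have int: "(arbitrary union_of ?B) (S \<inter> T)" if "?B S" "?B T" for S T
  proof -
    have "\<exists>W. ?B W \<and> A \<in> W \<and> W \<subseteq> S \<inter> T" if A: "A \<in> S \<inter> T" for A
    proof (cases "S = {A} \<or> T = {A}")
      case True
      then show ?thesis using A \<open>?B S\<close> \<open>?B T\<close> by (intro exI[of _ "{A}"]) auto
    next
      case False
      then obtain x y where "x \<in> carrier M" "y \<in> carrier M" "S = ?cone x" "T = ?cone y"
        using A \<open>?B S\<close> \<open>?B T\<close> by (auto simp: cone_base_def)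
      then show ?thesis using local_base A by simp
    qed
    then show ?thesis
      unfolding arbitrary_union_of_alt by blast
  qed
  then have ist: "istopology (arbitrary union_of ?B)"
    unfolding istopology_base_eq by blast
  show ?thesis
  proof (intro ext iffI)
    fix U assume "openin (cone_topology (carrier M) (monoid_le M)) U"
    then have "generate_topology_on (cone_base (carrier M) (monoid_le M)) U"
      by (simp add: cone_topology_def openin_topology_generated_by_iff)
    then show "(arbitrary union_of ?B) U"
    proof (induction rule: generate_topology_on.induct)
      case Empty
      show ?case by (simp add: arbitrary_union_of_empty)
    next
      case (Int a b)
      then show ?case using ist by (auto simp: istopology_def)
    next
      case (UN K)
      then show ?case by (intro arbitrary_union_of_Union) auto
    next
      case (Basis s)
      then show ?case by (intro arbitrary_union_of_inc)
    qed
  next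
    fix U assume "(arbitrary union_of ?B) U"
    then obtain \<U> where "\<U> \<subseteq> Collect ?B" "\<Union>\<U> = U"
      by (auto simp: union_of_def)
    then show "openin (cone_topology (carrier M) (monoid_le M)) U"
      unfolding cone_topology_def by (blast intro: topology_generated_by_Basis)
  qed
qed

definition boundary_borel :: "'a set \<Rightarrow> ('a \<Rightarrow> 'a \<Rightarrow> bool) \<Rightarrow> (nat \<Rightarrow> 'a) set measure"
  where "boundary_borel X R = sigma (univ_boundary X R)
    {U. openin (subtopology (cone_topology X R) (univ_boundary X R)) U}"


section \<open>Boundaries of monoids and the canonical measure\<close>

abbreviation monoid_seqs :: "('a, 'b) monoid_scheme \<Rightarrow> (nat \<Rightarrow> 'a) set"
  where "monoid_seqs M \<equiv> decreasing_seqs (carrier M) (monoid_le M)"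

abbreviation monoid_class :: "('a, 'b) monoid_scheme \<Rightarrow> (nat \<Rightarrow> 'a) \<Rightarrow> (nat \<Rightarrow> 'a) set"
  where "monoid_class M f \<equiv> seq_class (carrier M) (monoid_le M) f"

abbreviation monoid_boundary :: "('a, 'b) monoid_scheme \<Rightarrow> (nat \<Rightarrow> 'a) set set"
  where "monoid_boundary M \<equiv> univ_boundary (carrier M) (monoid_le M)"

abbreviation free_cover :: "('a, 'b) monoid_scheme \<Rightarrow> ('a \<Rightarrow> nat) \<Rightarrow> 'a list monoid"
  where "free_cover M deg \<equiv> free_monoid (degree_part M deg 1)"

abbreviation monoid_borel :: "('a, 'b) monoid_scheme \<Rightarrow> (nat \<Rightarrow> 'a) set measure"
  where "monoid_borel M \<equiv> boundary_borel (carrier M) (monoid_le M)"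

text \<open>For empty \<open>Y\<close> the free monoid is trivial, its boundary is empty, and no
  probability measure on it exists.\<close>

definition is_free_boundary_measure :: "'a set \<Rightarrow> (nat \<Rightarrow> 'a list) set measure \<Rightarrow> bool"
  where "is_free_boundary_measure Y \<mu> \<longleftrightarrow>
    prob_space \<mu> \<and> sets \<mu> = sets (monoid_borel (free_monoid Y)) \<and>
    (\<forall>t\<in>carrier (free_monoid Y).
       emeasure \<mu> (monoid_boundary (free_monoid Y) \<inter>
         completion_cone (carrier (free_monoid Y)) (monoid_le (free_monoid Y)) t)
       = ennreal (1 / real (card Y) ^ length t))"

definition free_boundary_measure :: "'a set \<Rightarrow> (nat \<Rightarrow> 'a list) set measure"
  where "free_boundary_measure Y = (THE \<mu>. is_free_boundary_measure Y \<mu>)"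

text \<open>The map \<open>[f] \<mapsto> [word_prod M \<circ> f]\<close>, as the only value taken on
  the representatives of a class.\<close>

definition boundary_map ::
    "('a, 'b) monoid_scheme \<Rightarrow> (nat \<Rightarrow> 'a list) set \<Rightarrow> (nat \<Rightarrow> 'a) set"
  where "boundary_map M A =
    the_elem ((\<lambda>f. monoid_class M (word_prod M \<circ> f)) ` A)"

definition monoid_boundary_measure ::
    "('a, 'b) monoid_scheme \<Rightarrow> ('a \<Rightarrow> nat) \<Rightarrow> (nat \<Rightarrow> 'a) set measure"
  where "monoid_boundary_measure M deg =
    distr (free_boundary_measure (degree_part M deg 1)) (monoid_borel M) (boundary_map M)"

end

theory Submission
  imports Defs
begin

text \<open>
  Since the monoid is countable and the singletons in the base of the cone topology miss the
  boundary, the Borel sets of the boundary are generated by the traces of the cones.  For the free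
  monoid these traces correspond to the cylinder sets of infinite words, so the
  canonical measure is the image of the uniform product measure; it is unique because two
  cones are nested or disjoint.  The boundary map is measurable because the preimage of
  the cone of \<open>x\<close> is the union of the cones of all words whose product lies below \<open>x\<close>.
\<close>

section \<open>Boundary points and cones in terms of representing sequences\<close>

context finitely_1_generated_monoid
begin

abbreviation cls where "cls \<equiv> monoid_class M"
abbreviation cone where "cone \<equiv> completion_cone (carrier M) (monoid_le M)"

text \<open>Words over the finite degree-one part are countable and map onto the carrier. This keeps
  the unions of base sets and of cones below countable.\<close>

lemma countable_carrier: "countable (carrier M)"
  using countable_lists[OF countable_finite[OF finite_degree_1]]
  by (subst one_generated[symmetric]) (simp add: free_monoid_def)

lemma const_in_D: "x \<in> carrier M \<Longrightarrow> (\<lambda>_. x) \<in> D"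
  by (auto simp: decreasing_seqs_def monoid_le_refl)

lemma D_closed: "u \<in> D \<Longrightarrow> u n \<in> carrier M"
  by (auto simp: decreasing_seqs_def)

lemma D_le: "u \<in> D \<Longrightarrow> n \<le> m \<Longrightarrow> monoid_le M (u m) (u n)"
  by (auto simp: decreasing_seqs_def)

lemma cls_self: "u \<in> D \<Longrightarrow> u \<in> cls u"
  by (simp add: seq_equiv_iff seq_le_refl)

lemma cls_eq_iff:
  assumes "u \<in> D" "v \<in> D"
  shows "cls u = cls v \<longleftrightarrow> seq_le (monoid_le M) u v \<and> seq_le (monoid_le M) v u"
proof
  assume "cls u = cls v"
  then have "u \<in> cls v" using cls_self[OF assms(1)] by (simp only:)
  then show "seq_le (monoid_le M) u v \<and> seq_le (monoid_le M) v u"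
    by (simp add: seq_equiv_iff)
next
  assume "seq_le (monoid_le M) u v \<and> seq_le (monoid_le M) v u"
  then show "cls u = cls v"
    using assms seq_le_trans unfolding set_eq_iff Image_singleton_iff seq_equiv_iff by metis
qed

lemma completion_cases:
  assumes "A \<in> poset_completion (carrier M) (monoid_le M)"
  obtains u where "u \<in> D" "A = cls u"
  using assms by (auto simp: poset_completion_def elim: quotientE)

lemma boundary_cases:
  assumes "A \<in> monoid_boundary M"
  obtains u where "u \<in> D" "A = cls u"
  using assms completion_cases by (auto simp: univ_boundary_def)

lemma cls_in_completion: "u \<in> D \<Longrightarrow> cls u \<in> poset_completion (carrier M) (monoid_le M)"
  by (auto simp: poset_completion_def intro: quotientI)

text \<open>Against a constant second sequence the outer quantifier of \<open>seq_le\<close> is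
  vacuous, so a single term below \<open>t\<close> decides.\<close>

lemma cls_in_cone_iff:
  assumes "u \<in> D" "t \<in> carrier M"
  shows "cls u \<in> cone t \<longleftrightarrow> (\<exists>k. monoid_le M (u k) t)"
  using assms const_in_D[of t]
  by (simp add: completion_cone_def cls_in_completion embed_def completion_le_class_iff seq_le_def)

lemma cone_mono:
  assumes "s \<in> carrier M" "t \<in> carrier M" "monoid_le M s t"
  shows "cone s \<subseteq> cone t"
proof
  fix A assume A: "A \<in> cone s"
  then have "A \<in> poset_completion (carrier M) (monoid_le M)"
    by (simp add: completion_cone_def)
  then obtain u where u: "u \<in> D" "A = cls u" by (rule completion_cases)
  with A assms show "A \<in> cone t"
    using cls_in_cone_iff monoid_le_trans by metis
qed

text \<open>If the degrees are bounded, take \<open>N\<close> where the degree is maximal: later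
  terms lie below \<open>u N\<close> with no larger degree, hence equal it, and the class is that of
  a constant sequence. Conversely, a class equal to that of the constant \<open>x\<close> has all
  degrees bounded by \<open>deg x\<close>.\<close>

lemma cls_in_boundary_iff:
  assumes u: "u \<in> D"
  shows "cls u \<in> monoid_boundary M \<longleftrightarrow> (\<forall>d. \<exists>n. d \<le> deg (u n))"
proof
  assume bd: "cls u \<in> monoid_boundary M"
  show "\<forall>d. \<exists>n. d \<le> deg (u n)"
  proof (rule ccontr)
    assume "\<not> ?thesis"
    then obtain d where "\<And>n. deg (u n) < d" by (auto simp: not_le)
    then have fin: "finite (range (\<lambda>n. deg (u n)))"
      by (auto intro: finite_subset[where B = "{..<d}"])
    then have "Max (range (\<lambda>n. deg (u n))) \<in> range (\<lambda>n. deg (u n))"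
      by (intro Max_in) auto
    then obtain N where "deg (u N) = Max (range (\<lambda>n. deg (u n)))" by auto
    then have N: "deg (u n) \<le> deg (u N)" for n
      using fin by simp
    have "monoid_le M (u N) (u n)" for n
    proof (cases "n \<le> N")
      case True
      then show ?thesis using D_le[OF u] by blast
    next
      case False
      then have "u n = u N"
        by (intro monoid_le_same_deg[OF D_closed[OF u] D_closed[OF u] D_le[OF u] N]) simp
      then show ?thesis by (simp add: monoid_le_refl)
    qed
    then have "cls u = cls (\<lambda>_. u N)"
      using monoid_le_refl
      by (subst cls_eq_iff[OF u const_in_D[OF D_closed[OF u]]]) (auto simp: seq_le_def)
    then show False
      using bd D_closed[OF u] by (auto simp: univ_boundary_def embed_def)
  qed
next
  assume unb: "\<forall>d. \<exists>n. d \<le> deg (u n)"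
  have "cls u \<noteq> cls (\<lambda>_. x)" if x: "x \<in> carrier M" for x
  proof
    assume "cls u = cls (\<lambda>_. x)"
    then have "monoid_le M x (u n)" for n
      using cls_eq_iff[OF u const_in_D[OF x]] by (auto simp: seq_le_def)
    then have "deg (u n) \<le> deg x" for n
      using monoid_le_deg x D_closed[OF u] by blast
    then show False using unb not_less_eq_eq by blast
  qed
  then show "cls u \<in> monoid_boundary M"
    using cls_in_completion[OF u] by (auto simp: univ_boundary_def embed_def)
qed

section \<open>Generation of the Borel sets by cones\<close>

lemma space_monoid_borel: "space (monoid_borel M) = monoid_boundary M"
  by (simp add: boundary_borel_def space_measure_of_conv)

abbreviation boundary_cones where
  "boundary_cones \<equiv> (\<lambda>t. monoid_boundary M \<inter> cone t) ` carrier M"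

lemma boundary_cones_subset: "boundary_cones \<subseteq> Pow (monoid_boundary M)"
  by auto

text \<open>Here it matters that \<open>cone_base\<close> is a base and not merely a subbase: every
  open set is a plain union of base sets, and the base is countable, being made of two images of the
  carrier.\<close>

lemma sets_monoid_borel:
  "sets (monoid_borel M) = sigma_sets (monoid_boundary M) boundary_cones"
proof -
  let ?B = "monoid_boundary M"
  let ?O = "{U. openin (subtopology (cone_topology (carrier M) (monoid_le M)) ?B) U}"
  have "U \<in> sigma_sets ?B boundary_cones" if U: "U \<in> ?O" for U
  proof -
    from U obtain T where "openin (cone_topology (carrier M) (monoid_le M)) T"
      and T: "U = T \<inter> ?B"
      unfolding mem_Collect_eq openin_subtopology by blast
    then have "(arbitrary union_of (\<lambda>U. U \<in> cone_base (carrier M) (monoid_le M))) T"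
      by (simp only: openin_cone_topology_iff)
    then obtain \<U> where \<U>: "\<U> \<subseteq> cone_base (carrier M) (monoid_le M)" "T = \<Union>\<U>"
      by (auto simp: union_of_def)
    have "countable \<U>"
      using countable_subset[OF \<U>(1)] countable_carrier by (simp add: cone_base_def)
    moreover have "W \<inter> ?B \<in> sigma_sets ?B boundary_cones" if "W \<in> \<U>" for W
    proof -
      from that \<U> consider x where "x \<in> carrier M" "W = {embed (carrier M) (monoid_le M) x}"
        | x where "x \<in> carrier M" "W = cone x"
        by (auto simp: cone_base_def)
      then show ?thesis
      proof cases
        \<comment> \<open>A point embedded from the monoid is by definition outside the boundary, so
          its trace is empty.\<close>
        case 1
        then have "W \<inter> ?B = {}" by (auto simp: univ_boundary_def)
        then show ?thesis by (simp only: sigma_sets.Empty)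
      next
        case 2
        then have "W \<inter> ?B \<in> boundary_cones" by blast
        then show ?thesis by (rule sigma_sets.Basic)
      qed
    qed
    ultimately have "(\<Union>W\<in>\<U>. W \<inter> ?B) \<in> sigma_sets ?B boundary_cones"
      by (intro sigma_sets_UNION) auto
    moreover have "U = (\<Union>W\<in>\<U>. W \<inter> ?B)" using T \<U>(2) by blast
    ultimately show ?thesis by simp
  qed
  moreover have "boundary_cones \<subseteq> ?O"
  proof
    fix A assume "A \<in> boundary_cones"
    then obtain t where t: "t \<in> carrier M" "A = ?B \<inter> cone t" by blast
    then have "openin (cone_topology (carrier M) (monoid_le M)) (cone t)"
      unfolding cone_topology_def
      by (intro topology_generated_by_Basis) (simp add: cone_base_def)
    then show "A \<in> ?O" using t by (auto simp: openin_subtopology_Int2)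
  qed
  ultimately have "sigma_sets ?B ?O = sigma_sets ?B boundary_cones"
    by (intro equalityI sigma_sets_mono subsetI) (blast, blast intro: sigma_sets.Basic)
  moreover have "?O \<subseteq> Pow ?B"
    by (auto simp: openin_subtopology)
  ultimately show ?thesis
    by (simp add: boundary_borel_def)
qed

end


section \<open>The canonical measure on the boundary of a free monoid\<close>

lemma carrier_free_monoid: "carrier (free_monoid Y) = lists Y"
  by (simp add: free_monoid_def)

lemma in_carrier_free_monoid: "w \<in> carrier (free_monoid Y) \<longleftrightarrow> w \<in> lists Y"
  by (simp add: free_monoid_def)

lemma word_prod_free_monoid: "word_prod (free_monoid Y) ws = concat ws"
  by (induction ws) (simp_all add: word_prod_def free_monoid_def)

text \<open>Every word is the concatenation of its one-letter words, which are the elements of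
  degree one. The general facts on cones thus apply to free monoids too.\<close>

lemma finitely_1_generated_free_monoid:
  assumes "finite Y"
  shows "finitely_1_generated_monoid (free_monoid Y) length"
proof -
  have deg1: "degree_part (free_monoid Y) length 1 = (\<lambda>y. [y]) ` Y"
    by (auto simp: degree_part_def free_monoid_def length_Suc_conv)
  interpret graded_monoid "free_monoid Y" length
    by unfold_locales (auto simp: free_monoid_def)
  have "w \<in> concat ` lists ((\<lambda>y. [y]) ` Y)" if "w \<in> lists Y" for w
    using that by (intro image_eqI[of _ _ "map (\<lambda>y. [y]) w"]) auto
  then have "word_prod (free_monoid Y) ` carrier (free_monoid
      (degree_part (free_monoid Y) length 1)) = carrier (free_monoid Y)"
    unfolding deg1 carrier_free_monoid by (fastforce simp: word_prod_free_monoid)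
  then show ?thesis
    using assms by unfold_locales (simp_all add: deg1[unfolded One_nat_def])
qed

text \<open>Puts prefix equality into the letterwise form in which \<open>sstart_eq\<close>
  describes cylinders.\<close>

lemma stake_eq_iff: "stake (length t) s = t \<longleftrightarrow> (\<forall>i<length t. s !! i = t ! i)"
  by (auto simp: list_eq_iff_nth_eq)

lemma stake_in_lists: "s \<in> streams Y \<Longrightarrow> stake n s \<in> lists Y"
  by (induction n arbitrary: s) (auto simp: streams_shd streams_stl)

section \<open>Cones of words, and uniqueness of the canonical measure\<close>

locale finite_alphabet =
  fixes Y :: "'a set"
  assumes finite_alphabet: "finite Y" and alphabet_nonempty: "Y \<noteq> {}"
begin

sublocale free: finitely_1_generated_monoid "free_monoid Y" length
  by (rule finitely_1_generated_free_monoid[OF finite_alphabet])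

text \<open>Multiplying on the right extends a word, so descending in the order means passing to
  longer words.\<close>

lemma free_le_iff_prefix:
  assumes "x \<in> lists Y" "y \<in> lists Y"
  shows "monoid_le (free_monoid Y) x y \<longleftrightarrow> prefix y x"
  using assms
  by (auto simp: free.monoid_le_iff carrier_free_monoid prefix_def) (auto simp: free_monoid_def)

lemma cls_in_free_cone_iff:
  assumes "u \<in> free.D" "t \<in> lists Y"
  shows "free.cls u \<in> free.cone t \<longleftrightarrow> (\<exists>k. prefix t (u k))"
proof -
  have "u k \<in> lists Y" for k
    using free.D_closed[OF assms(1)] by (simp only: carrier_free_monoid)
  then have "monoid_le (free_monoid Y) (u k) t \<longleftrightarrow> prefix t (u k)" for k
    using free_le_iff_prefix assms(2) by blast
  then show ?thesis
    using free.cls_in_cone_iff[of u t] assms by (simp only: in_carrier_free_monoid)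
qed

text \<open>A sequence representing a common point has a term extending \<open>s\<close> and a term
  extending \<open>t\<close>. The later of the two extends both, and two prefixes of one word are
  comparable.\<close>

lemma free_cones_nested_or_disjoint:
  assumes "s \<in> lists Y" "t \<in> lists Y" "free.cone s \<inter> free.cone t \<noteq> {}"
  shows "prefix s t \<or> prefix t s"
proof -
  from assms(3) obtain A where A: "A \<in> free.cone s" "A \<in> free.cone t" by blast
  then have "A \<in> poset_completion (carrier (free_monoid Y)) (monoid_le (free_monoid Y))"
    by (simp add: completion_cone_def)
  then obtain u where u: "u \<in> free.D" "A = free.cls u" by (rule free.completion_cases)
  with A assms obtain i j where ij: "prefix s (u i)" "prefix t (u j)"
    using cls_in_free_cone_iff by metis
  have "prefix (u n) (u (max i j))" if "n \<le> max i j" for n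
    using free_le_iff_prefix[of "u (max i j)" "u n"] free.D_le[OF u(1) that] free.D_closed[OF u(1)]
    by (simp only: in_carrier_free_monoid)
  then have "prefix s (u (max i j))" "prefix t (u (max i j))"
    using ij prefix_order.trans max.cobounded1 max.cobounded2 by metis+
  then show ?thesis using prefix_same_cases by metis
qed

text \<open>The empty set is adjoined to account for disjoint cones; for nested ones the
  intersection is the smaller cone.\<close>

lemma Int_stable_free_cones: "Int_stable (insert {} free.boundary_cones)"
proof -
  have "(monoid_boundary (free_monoid Y) \<inter> free.cone s) \<inter>
      (monoid_boundary (free_monoid Y) \<inter> free.cone t) \<in> insert {} free.boundary_cones"
    if st: "s \<in> carrier (free_monoid Y)" "t \<in> carrier (free_monoid Y)" for s t
  proof (cases "free.cone s \<inter> free.cone t = {}")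
    case False
    then consider "prefix s t" | "prefix t s"
      using st free_cones_nested_or_disjoint unfolding carrier_free_monoid by blast
    then have "free.cone s \<inter> free.cone t = free.cone s \<or>
        free.cone s \<inter> free.cone t = free.cone t"
      using st free.cone_mono[of s t] free.cone_mono[of t s] free_le_iff_prefix
      unfolding carrier_free_monoid by cases blast+
    then have "(monoid_boundary (free_monoid Y) \<inter> free.cone s) \<inter>
        (monoid_boundary (free_monoid Y) \<inter> free.cone t) \<in>
        {monoid_boundary (free_monoid Y) \<inter> free.cone s,
         monoid_boundary (free_monoid Y) \<inter> free.cone t}"
      by blast
    then show ?thesis using st by blast
  qed blast
  then show ?thesis unfolding Int_stable_def by blast
qed

lemma sets_free_borel:
  "sets (monoid_borel (free_monoid Y)) =
    sigma_sets (monoid_boundary (free_monoid Y)) (insert {} free.boundary_cones)"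
  unfolding free.sets_monoid_borel
  by (intro sigma_sets_eqI) (auto intro: sigma_sets.Empty)

text \<open>Makes the whole boundary a generator, which supplies the exhausting sequence in the
  uniqueness argument.\<close>

lemma boundary_Int_cone_Nil:
  "monoid_boundary (free_monoid Y) \<inter> free.cone [] = monoid_boundary (free_monoid Y)"
proof -
  have "A \<in> free.cone []" if "A \<in> monoid_boundary (free_monoid Y)" for A
  proof -
    from that obtain u where u: "u \<in> free.D" "A = free.cls u" by (rule free.boundary_cases)
    then show ?thesis by (simp add: cls_in_free_cone_iff)
  qed
  then show ?thesis by blast
qed

text \<open>Both measures have the prescribed values on an intersection-stable generator that
  contains the whole space, where they are finite.\<close>

lemma free_boundary_measure_unique:
  assumes "is_free_boundary_measure Y \<mu>" "is_free_boundary_measure Y \<nu>"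
  shows "\<mu> = \<nu>"
proof (rule measure_eqI_generator_eq[OF Int_stable_free_cones])
  let ?B = "monoid_boundary (free_monoid Y)"
  show "insert {} free.boundary_cones \<subseteq> Pow ?B" by auto
  show "emeasure \<mu> X = emeasure \<nu> X" if "X \<in> insert {} free.boundary_cones" for X
    using that assms by (auto simp: is_free_boundary_measure_def)
  show "sets \<mu> = sigma_sets ?B (insert {} free.boundary_cones)"
    "sets \<nu> = sigma_sets ?B (insert {} free.boundary_cones)"
    using assms sets_free_borel by (simp_all add: is_free_boundary_measure_def)
  show "range (\<lambda>_::nat. ?B) \<subseteq> insert {} free.boundary_cones"
    using boundary_Int_cone_Nil
    by (auto simp: in_carrier_free_monoid intro!: image_eqI[of _ _ "[]"])
  show "(\<Union>i::nat. ?B) = ?B" by simp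
  interpret prob_space \<mu> using assms by (simp add: is_free_boundary_measure_def)
  show "emeasure \<mu> ?B \<noteq> \<infinity>" by simp
qed

section \<open>Existence of the canonical measure by way of random infinite words\<close>

abbreviation letters where "letters \<equiv> uniform_count_measure Y"

sublocale P: prob_space letters
  using finite_alphabet alphabet_nonempty by (rule prob_space_uniform_count_measure)

text \<open>Pushing the product measure on infinite words forward along this map will give the
  canonical measure.\<close>

definition stream_end :: "'a stream \<Rightarrow> (nat \<Rightarrow> 'a list) set"
  where "stream_end s = free.cls (\<lambda>n. stake n s)"

lemma space_words: "space (stream_space letters) = streams Y"
  by (simp add: space_stream_space space_uniform_count_measure)

text \<open>The description of the product sigma-algebra by cylinders,
  \<open>sets_stream_space_sstart\<close>, is about \<open>count_space\<close>.\<close>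

lemma sets_words: "sets (stream_space letters) = sets (stream_space (count_space Y))"
  by (intro sets_stream_space_cong) (rule sets_uniform_count_measure_count_space)

lemma sstart_in_words:
  assumes "w \<in> lists Y"
  shows "sstart Y w \<in> sets (stream_space letters)"
proof -
  from assms have "sstart Y w \<in> sigma_sets (streams Y) (sstart Y ` lists Y \<union> {{}})"
    by (intro sigma_sets.Basic) blast
  moreover have "sstart Y ` lists Y \<union> {{}} \<subseteq> Pow (streams Y)"
    by (simp add: image_subset_iff sstart_in_streams)
  ultimately show ?thesis
    using finite_alphabet
    by (simp only: sets_words sets_stream_space_sstart countable_finite sets_measure_of)
qed

text \<open>Induction on the word: the first letter is independent of the rest, so each letter
  contributes a factor \<open>1 / card Y\<close>.\<close>

lemma emeasure_sstart:
  "w \<in> lists Y \<Longrightarrow>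
    emeasure (stream_space letters) (sstart Y w) = ennreal (1 / real (card Y) ^ length w)"
proof (induction w)
  case Nil
  have "emeasure (stream_space letters) (space (stream_space letters)) = 1"
    using P.prob_space_stream_space by (rule prob_space.emeasure_space_1)
  then show ?case by (simp add: space_words)
next
  case (Cons y w)
  let ?p = "emeasure (stream_space letters) (sstart Y w)"
  have sub: "sstart Y w \<subseteq> streams Y"
    using Cons.prems by (intro sstart_in_streams) simp
  have "emeasure (stream_space letters) (sstart Y (y # w)) =
      (\<integral>\<^sup>+a. emeasure (stream_space letters)
        {s \<in> space (stream_space letters). a ## s \<in> sstart Y (y # w)} \<partial>letters)"
    by (rule P.emeasure_stream_space[OF sstart_in_words[OF Cons.prems]])
  \<comment> \<open>Prepending \<open>a\<close> reaches the cylinder only for \<open>a = y\<close>,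
    and then the section is \<open>sstart Y w\<close>.\<close>
  also have "\<dots> = (\<integral>\<^sup>+a. ?p * indicator {y} a \<partial>letters)"
  proof (intro nn_integral_cong)
    fix a
    have "{s \<in> space (stream_space letters). a ## s \<in> sstart Y (y # w)} =
        (if a = y then sstart Y w else {})"
      using sub by (auto simp: space_words)
    then show "emeasure (stream_space letters)
        {s \<in> space (stream_space letters). a ## s \<in> sstart Y (y # w)} = ?p * indicator {y} a"
      by simp
  qed
  also have "\<dots> = ?p * emeasure letters {y}"
    using Cons.prems by (intro nn_integral_cmult_indicator) (simp add: sets_uniform_count_measure)
  also have "\<dots> = ennreal (1 / real (card Y) ^ length w) * ennreal (1 / real (card Y))"
    using Cons finite_alphabet by (simp add: emeasure_uniform_count_measure)
  also have "\<dots> = ennreal (1 / real (card Y) ^ length (y # w))"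
    by (simp add: mult.commute flip: ennreal_mult)
  finally show ?case .
qed

lemma stake_in_D:
  assumes "s \<in> streams Y"
  shows "(\<lambda>n. stake n s) \<in> free.D"
proof -
  have "prefix (stake n s) (stake m s)" if "n \<le> m" for n m
    by (metis take_is_prefix take_stake min.absorb1 that)
  then show ?thesis
    using stake_in_lists[OF assms]
    by (simp add: decreasing_seqs_def in_carrier_free_monoid free_le_iff_prefix image_subset_iff)
qed

text \<open>The prefix \<open>stake n s\<close> has degree \<open>n\<close>, so the degrees are
  unbounded.\<close>

lemma stream_end_in_boundary: "s \<in> streams Y \<Longrightarrow> stream_end s \<in> monoid_boundary (free_monoid Y)"
  unfolding stream_end_def
  by (subst free.cls_in_boundary_iff) (auto simp: stake_in_D)

text \<open>A prefix of \<open>s\<close> that extends \<open>t\<close> can be cut back to length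
  \<open>length t\<close>, so only the first \<open>length t\<close> letters matter and cones turn
  into cylinders.\<close>

lemma stream_end_in_cone_iff:
  assumes s: "s \<in> streams Y" and t: "t \<in> lists Y"
  shows "stream_end s \<in> free.cone t \<longleftrightarrow> s \<in> sstart Y t"
proof -
  have "stream_end s \<in> free.cone t \<longleftrightarrow> (\<exists>k. prefix t (stake k s))"
    unfolding stream_end_def by (rule cls_in_free_cone_iff[OF stake_in_D[OF s] t])
  also have "\<dots> \<longleftrightarrow> stake (length t) s = t"
  proof
    assume "\<exists>k. prefix t (stake k s)"
    then obtain k where k: "prefix t (stake k s)" by blast
    then have "length t \<le> k" using prefix_length_le by fastforce
    moreover have "take (length t) (stake k s) = t"
      using k by (auto simp: prefix_def)
    ultimately show "stake (length t) s = t" by (simp add: take_stake min_def)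
  qed (metis prefix_order.order_refl)
  also have "\<dots> \<longleftrightarrow> s \<in> sstart Y t"
    by (simp add: stake_eq_iff sstart_eq[OF s])
  finally show ?thesis .
qed

lemma stream_end_vimage_cone:
  assumes t: "t \<in> lists Y"
  shows "stream_end -` (monoid_boundary (free_monoid Y) \<inter> free.cone t) \<inter>
    space (stream_space letters) = sstart Y t"
  using stream_end_in_cone_iff[OF _ t] stream_end_in_boundary sstart_in_streams[OF t]
  by (auto simp: space_words)

text \<open>It suffices to test the generating cones, whose preimages are cylinders.\<close>

lemma measurable_stream_end:
  "stream_end \<in> stream_space letters \<rightarrow>\<^sub>M monoid_borel (free_monoid Y)"
proof (rule measurable_sigma_sets[OF free.sets_monoid_borel free.boundary_cones_subset])
  show "stream_end \<in> space (stream_space letters) \<rightarrow> monoid_boundary (free_monoid Y)"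
    using stream_end_in_boundary by (auto simp: space_words)
  show "stream_end -` A \<inter> space (stream_space letters) \<in> sets (stream_space letters)"
    if "A \<in> free.boundary_cones" for A
  proof -
    from that obtain t where "t \<in> lists Y" "A = monoid_boundary (free_monoid Y) \<inter> free.cone t"
      unfolding carrier_free_monoid by blast
    then show ?thesis using stream_end_vimage_cone sstart_in_words by metis
  qed
qed

lemma is_free_boundary_measure_distr:
  "is_free_boundary_measure Y
    (distr (stream_space letters) (monoid_borel (free_monoid Y)) stream_end)"
proof -
  let ?\<mu> = "distr (stream_space letters) (monoid_borel (free_monoid Y)) stream_end"
  have "emeasure ?\<mu> (monoid_boundary (free_monoid Y) \<inter> free.cone t) =
      ennreal (1 / real (card Y) ^ length t)" if t: "t \<in> carrier (free_monoid Y)" for t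
  proof -
    have "monoid_boundary (free_monoid Y) \<inter> free.cone t \<in> sets (monoid_borel (free_monoid Y))"
      unfolding free.sets_monoid_borel using t by (intro sigma_sets.Basic imageI)
    moreover have "t \<in> lists Y" using t by (simp only: carrier_free_monoid)
    ultimately show ?thesis
      by (simp only: emeasure_distr[OF measurable_stream_end] stream_end_vimage_cone emeasure_sstart)
  qed
  then show ?thesis
    unfolding is_free_boundary_measure_def
    using prob_space.prob_space_distr[OF P.prob_space_stream_space measurable_stream_end]
    by simp
qed

text \<open>Existence and uniqueness together give the definite description in
  \<open>free_boundary_measure\<close> its meaning.\<close>

lemma is_free_boundary_measure_free_boundary_measure:
  "is_free_boundary_measure Y (free_boundary_measure Y)"
  unfolding free_boundary_measure_def
  using is_free_boundary_measure_distr
  by (rule theI) (rule free_boundary_measure_unique[OF _ is_free_boundary_measure_distr])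

end


section \<open>The boundary map\<close>

context finitely_1_generated_monoid
begin

text \<open>Closure is proved along with the product formula because associativity in the induction
  step needs the product of \<open>v\<close> to lie in the carrier.\<close>

lemma word_prod_append:
  "v \<in> lists (carrier M) \<Longrightarrow> w \<in> lists (carrier M) \<Longrightarrow>
    word_prod M v \<in> carrier M \<and> word_prod M (v @ w) = word_prod M v \<otimes> word_prod M w"
proof (induction v)
  case Nil
  have "word_prod M w \<in> carrier M"
    using Nil(2) by (induction w) (auto simp: word_prod_def)
  then show ?case by (simp add: word_prod_def)
next
  case (Cons a v)
  moreover have "word_prod M w \<in> carrier M"
    using Cons(3) by (induction w) (auto simp: word_prod_def)
  ultimately show ?case by (simp add: word_prod_def m_assoc)
qed

end

text \<open>The alphabet is a parameter fixed by an equation, so that facts on the free cover can be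
  stated for a variable \<open>Y\<close>. Nonemptiness excludes the trivial monoid, whose boundary
  is empty.\<close>

locale monoid_with_free_cover = finitely_1_generated_monoid M deg for M (structure) and deg +
  fixes Y
  assumes Y_eq: "Y = degree_part M deg 1" and Y_nonempty: "Y \<noteq> {}"
begin

sublocale cover: finite_alphabet Y
  by unfold_locales (simp_all only: Y_eq finite_degree_1 Y_nonempty[unfolded Y_eq] not_False_eq_True)

abbreviation "F \<equiv> free_monoid Y"

lemma word_prod_cover:
  assumes "w \<in> carrier F"
  shows "word_prod M w \<in> carrier M" "deg (word_prod M w) = length w"
  using word_prod_degree[of w] assms unfolding Y_eq carrier_free_monoid by auto

text \<open>A word below \<open>w\<close> has the form \<open>w @ z\<close>, so its product is that
  of \<open>w\<close> times a further factor.\<close>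

lemma word_prod_mono:
  assumes vw: "v \<in> carrier F" "w \<in> carrier F" "monoid_le F v w"
  shows "monoid_le M (word_prod M v) (word_prod M w)"
proof -
  obtain z where z: "z \<in> carrier F" "v = w @ z"
    using cover.free.monoid_le_iff[OF vw(1,2)] vw(3) by (auto simp: free_monoid_def)
  have "carrier F \<subseteq> lists (carrier M)"
    by (auto simp: in_carrier_free_monoid Y_eq degree_part_def)
  then have "word_prod M v = word_prod M w \<otimes> word_prod M z"
    using word_prod_append[of w z] z vw by auto
  then show ?thesis
    using vw z word_prod_cover by (metis monoid_le_iff)
qed

lemma word_prod_comp_in_D:
  assumes f: "f \<in> cover.free.D"
  shows "word_prod M \<circ> f \<in> D"
  using word_prod_mono[OF cover.free.D_closed[OF f] cover.free.D_closed[OF f] cover.free.D_le[OF f]]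
    word_prod_cover(1)[OF cover.free.D_closed[OF f]]
  by (auto simp: decreasing_seqs_def)

lemma seq_le_word_prod:
  assumes "f \<in> cover.free.D" "g \<in> cover.free.D" "seq_le (monoid_le F) f g"
  shows "seq_le (monoid_le M) (word_prod M \<circ> f) (word_prod M \<circ> g)"
  using assms(3) word_prod_mono[OF cover.free.D_closed[OF assms(1)] cover.free.D_closed[OF assms(2)]]
  unfolding seq_le_def comp_def by blast

text \<open>\<open>the_elem\<close> is meaningful only on a singleton. Equivalent sequences lie
  below each other, this survives the monotone \<open>word_prod M\<close>, and so all
  representatives yield one class.\<close>

lemma boundary_map_cls:
  assumes f: "f \<in> cover.free.D"
  shows "boundary_map M (cover.free.cls f) = cls (word_prod M \<circ> f)"
  unfolding boundary_map_def
proof (rule the_elem_image_unique)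
  show "cover.free.cls f \<noteq> {}" using cover.free.cls_self[OF f] by blast
  fix g assume "g \<in> cover.free.cls f"
  then have "g \<in> cover.free.D" "seq_le (monoid_le F) f g" "seq_le (monoid_le F) g f"
    by (simp_all add: cover.free.seq_equiv_iff)
  with f show "cls (word_prod M \<circ> g) = cls (word_prod M \<circ> f)"
    by (simp add: cls_eq_iff word_prod_comp_in_D seq_le_word_prod)
qed

text \<open>The product of a word has its length as degree, so unbounded degrees stay
  unbounded.\<close>

lemma boundary_map_in_boundary:
  assumes "A \<in> monoid_boundary F"
  shows "boundary_map M A \<in> monoid_boundary M"
proof -
  from assms obtain f where f: "f \<in> cover.free.D" "A = cover.free.cls f"
    by (rule cover.free.boundary_cases)
  with assms show ?thesis
    by (simp add: boundary_map_cls cls_in_boundary_iff cover.free.cls_in_boundary_iff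
        word_prod_comp_in_D word_prod_cover(2)[OF cover.free.D_closed])
qed

text \<open>Words with product exactly \<open>x\<close> would not suffice: in the free commutative
  monoid on a and b, the word ba has product below a, yet no prefix of it has product a.\<close>

lemma boundary_map_vimage_cone:
  assumes x: "x \<in> carrier M"
  shows "boundary_map M -` (monoid_boundary M \<inter> cone x) \<inter> monoid_boundary F =
    (\<Union>w\<in>{w \<in> carrier F. monoid_le M (word_prod M w) x}. monoid_boundary F \<inter> cover.free.cone w)"
    (is "?L = ?R")
proof -
  have "A \<in> ?L \<longleftrightarrow> A \<in> ?R" if A: "A \<in> monoid_boundary F" for A
  proof -
    from A obtain f where f: "f \<in> cover.free.D" "A = cover.free.cls f"
      by (rule cover.free.boundary_cases)
    have "A \<in> ?L \<longleftrightarrow> (\<exists>k. monoid_le M (word_prod M (f k)) x)"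
      using A boundary_map_in_boundary[OF A] f x
      by (simp add: boundary_map_cls cls_in_cone_iff word_prod_comp_in_D)
    \<comment> \<open>Forwards, \<open>f k\<close> itself serves as \<open>w\<close>; backwards,
      \<open>word_prod_mono\<close> and transitivity carry the bound from \<open>w\<close> to
      \<open>f k\<close>.\<close>
    also have "\<dots> \<longleftrightarrow> (\<exists>w\<in>carrier F. monoid_le M (word_prod M w) x \<and> (\<exists>k. monoid_le F (f k) w))"
      using cover.free.D_closed[OF f(1)] cover.free.monoid_le_refl word_prod_mono monoid_le_trans
      by metis
    also have "\<dots> \<longleftrightarrow> A \<in> ?R"
      using A f by (auto simp: cover.free.cls_in_cone_iff)
    finally show ?thesis .
  qed
  then show ?thesis by blast
qed

lemma measurable_boundary_map: "boundary_map M \<in> monoid_borel F \<rightarrow>\<^sub>M monoid_borel M"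
proof (rule measurable_sigma_sets[OF sets_monoid_borel boundary_cones_subset])
  show "boundary_map M \<in> space (monoid_borel F) \<rightarrow> monoid_boundary M"
    using boundary_map_in_boundary by (simp add: cover.free.space_monoid_borel)
  fix A assume "A \<in> boundary_cones"
  then obtain x where x: "x \<in> carrier M" "A = monoid_boundary M \<inter> cone x" by blast
  have "(\<Union>w\<in>{w \<in> carrier F. monoid_le M (word_prod M w) x}.
      monoid_boundary F \<inter> cover.free.cone w) \<in> sets (monoid_borel F)"
  proof (rule sets.countable_UN'')
    show "countable {w \<in> carrier F. monoid_le M (word_prod M w) x}"
      using cover.free.countable_carrier by (rule countable_subset[rotated]) blast
  qed (auto simp: cover.free.sets_monoid_borel)
  then show "boundary_map M -` A \<inter> space (monoid_borel F) \<in> sets (monoid_borel F)"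
    unfolding x(2) cover.free.space_monoid_borel boundary_map_vimage_cone[OF x(1)] .
qed

end

theorem theoremB:
  fixes M :: "('a, 'b) monoid_scheme" and deg :: "'a \<Rightarrow> nat"
  assumes "finitely_1_generated_monoid M deg"
    and "degree_part M deg 1 \<noteq> {}"
  shows "boundary_map M \<in> monoid_borel (free_cover M deg) \<rightarrow>\<^sub>M monoid_borel M \<and>
    (\<forall>f \<in> monoid_seqs (free_cover M deg).
       monoid_class (free_cover M deg) f \<in> monoid_boundary (free_cover M deg) \<longrightarrow>
       boundary_map M (monoid_class (free_cover M deg) f) = monoid_class M (word_prod M \<circ> f)) \<and>
    prob_space (monoid_boundary_measure M deg) \<and>
    sets (monoid_boundary_measure M deg) = sets (monoid_borel M) \<and>
    (\<forall>A \<in> sets (monoid_borel M).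
       emeasure (monoid_boundary_measure M deg) A =
       emeasure (free_boundary_measure (degree_part M deg 1))
         (boundary_map M -` A \<inter> monoid_boundary (free_cover M deg)))"
proof -
  define Y where "Y = degree_part M deg 1"
  interpret monoid_with_free_cover M deg Y
    using assms unfolding Y_def
    by (intro monoid_with_free_cover.intro monoid_with_free_cover_axioms.intro refl)
  let ?\<mu> = "free_boundary_measure Y"
  have \<mu>: "prob_space ?\<mu>" and sets_\<mu>: "sets ?\<mu> = sets (monoid_borel F)"
    using cover.is_free_boundary_measure_free_boundary_measure
    by (simp_all add: is_free_boundary_measure_def)
  have space_\<mu>: "space ?\<mu> = monoid_boundary F"
    using sets_eq_imp_space_eq[OF sets_\<mu>] by (simp only: cover.free.space_monoid_borel)
  have meas: "boundary_map M \<in> ?\<mu> \<rightarrow>\<^sub>M monoid_borel M"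
    using measurable_boundary_map by (simp add: measurable_cong_sets[OF sets_\<mu> refl])
  show ?thesis
    unfolding monoid_boundary_measure_def Y_def[symmetric]
    using measurable_boundary_map boundary_map_cls prob_space.prob_space_distr[OF \<mu> meas]
    by (simp add: emeasure_distr[OF meas] space_\<mu>)
qed

end
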